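(* Let $n$ be a positive integer. There exists a bijective map $\varphi : \Pi_n \to \Sigma_{n^2}$ such that for all $P, Q \in \Pi_n$, the matrices $P$ and $Q$ are disjoint (in the sense of $\Pi_n$ matrices) if and only if $\varphi(P)$ and $\varphi(Q)$ are disjoint (in the sense of binary matrices).
   Context: Let $\mathbb{Z}_n = \{1,2,\ldots,n\}$. $\Pi_n$ denotes the set of all $(2n)\times n$ matrices with entries in $\mathbb{Z}_n$ in which every row is a permutation of all elements of $\mathbb{Z}_n$. Two matrices $C=[c_{ij}]_{2n\times n}$ and $D=[d_{ij}]_{2n\times n}$ in $\Pi_n$ (rows indexed $1,\ldots,2n$, columns $1,\ldots,n$) are called disjoint if there are no $s,t \in \{1,\ldots,n\}$ such that the ordered pair $\langle c_{st}, c_{n+t,\,s}\rangle$ equals the ordered pair $\langle d_{st}, d_{n+t,\,s}\rangle$. A binary matrix is a matrix with entries in $\{0,1\}$. A square binary matrix is a permutation matrix if it has exactly one 1 in every row and every column. $\Sigma_{n^2}$ denotes the set of all $n^2\times n^2$ binary permutation matrices $A$ which, when partitioned into $n^2$ blocks $A_{st}$ ($0\le s,t\le n-1$) of size $n\times n$ (block $A_{st}$ consisting of rows $sn,\ldots,sn+n-1$ and columns $tn,\ldots,tn+n-1$, indices starting at 0), have exactly one entry equal to 1 in each block $A_{st}$ (such matrices are called S-permutation matrices). Two binary matrices $A=[a_{ij}]$ and $B=[b_{ij}]$ of the same size are disjoint if there are no indices $i,j$ with $a_{ij}=b_{ij}=1$. *)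

theory Defs
  imports "Jordan_Normal_Form.Matrix"
begin

text \<open>Matrix indices start at 0 (so row and column \<open>k\<close> here is row and column \<open>k + 1\<close> of a
  1-based presentation), whereas the entries of the matrices in \<open>Pi_mats n\<close> range over
  \<open>{1, \<dots>, n}\<close>.\<close>

definition Pi_mats :: "nat \<Rightarrow> nat mat set" where
  "Pi_mats n = {C \<in> carrier_mat (2 * n) n. elements_mat C \<subseteq> {1..n} \<and>
     (\<forall>i < 2 * n. bij_betw (\<lambda>j. C $$ (i, j)) {..<n} {1..n})}"

definition Pi_disjoint :: "nat \<Rightarrow> nat mat \<Rightarrow> nat mat \<Rightarrow> bool" where
  "Pi_disjoint n C D \<longleftrightarrow>
     \<not> (\<exists>s < n. \<exists>t < n. (C $$ (s, t), C $$ (n + t, s)) = (D $$ (s, t), D $$ (n + t, s)))"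

definition binary_mat :: "nat mat \<Rightarrow> bool" where
  "binary_mat A \<longleftrightarrow> elements_mat A \<subseteq> {0, 1}"

definition permutation_mat :: "nat mat \<Rightarrow> bool" where
  "permutation_mat A \<longleftrightarrow> square_mat A \<and> binary_mat A \<and>
     (\<forall>i < dim_row A. \<exists>!j. j < dim_col A \<and> A $$ (i, j) = 1) \<and>
     (\<forall>j < dim_col A. \<exists>!i. i < dim_row A \<and> A $$ (i, j) = 1)"

definition mat_block :: "nat \<Rightarrow> nat mat \<Rightarrow> nat \<Rightarrow> nat \<Rightarrow> nat mat" where
  "mat_block n A s t = mat n n (\<lambda>(i, j). A $$ (s * n + i, t * n + j))"

definition Sigma_mats :: "nat \<Rightarrow> nat mat set" where
  "Sigma_mats n = {A \<in> carrier_mat (n\<^sup>2) (n\<^sup>2). permutation_mat A \<and>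
     (\<forall>s < n. \<forall>t < n. \<exists>!p. p \<in> {..<n} \<times> {..<n} \<and> mat_block n A s t $$ p = 1)}"

text \<open>Only meaningful for two matrices of the same size.\<close>

definition binary_disjoint :: "nat mat \<Rightarrow> nat mat \<Rightarrow> bool" where
  "binary_disjoint A B \<longleftrightarrow>
     \<not> (\<exists>i < dim_row A. \<exists>j < dim_col A. A $$ (i, j) = 1 \<and> B $$ (i, j) = 1)"

end

theory Submission
  imports Defs
begin

text \<open>An \<open>n\<^sup>2 \<times> n\<^sup>2\<close> binary matrix with a single \<open>1\<close> in each block amounts to recording, for every
  block \<open>(s, t)\<close>, the position \<open>(a, b)\<close> of that \<open>1\<close>, and a \<open>2n \<times> n\<close> matrix \<open>C\<close> with entries in
  \<open>{1, \<dots>, n}\<close> records the pairs \<open>(C(s, t), C(n + t, s))\<close>. Identifying \<open>(C(s, t), C(n + t, s))\<close>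
  with \<open>(a + 1, b + 1)\<close> gives a bijection that preserves disjointness. Moreover row \<open>sn + a\<close> has
  exactly one \<open>1\<close> iff \<open>a + 1\<close> occurs exactly once in row \<open>s\<close> of \<open>C\<close>, and column \<open>tn + b\<close> has exactly
  one \<open>1\<close> iff \<open>b + 1\<close> occurs exactly once in row \<open>n + t\<close> of \<open>C\<close>, so the permutation conditions on
  the two sides correspond.\<close>

section \<open>Splitting an index below \<open>n\<^sup>2\<close> into block number and
  offset\<close>

lemma block_index_less:
  fixes s a n :: nat
  assumes "s < n" "a < n"
  shows "s * n + a < n\<^sup>2"
proof -
  have "s * n + a < Suc s * n" using assms(2) by simp
  also have "\<dots> \<le> n * n" using assms(1) by (intro mult_le_mono1) simp
  finally show ?thesis by (simp add: power2_eq_square)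
qed

lemma block_indexE:
  fixes i n :: nat
  assumes "i < n\<^sup>2"
  obtains s a where "s < n" "a < n" "i = s * n + a"
proof -
  have "n > 0" using assms by (cases n) auto
  then have "i mod n < n" by simp
  moreover have "i div n < n"
    using assms by (simp add: less_mult_imp_div_less power2_eq_square)
  ultimately show ?thesis using that[of "i div n" "i mod n"] by simp
qed

lemma block_index_inj:
  fixes s a n :: nat
  assumes "a < n" "a' < n"
  shows "s * n + a = s' * n + a' \<longleftrightarrow> s = s' \<and> a = a'"
proof
  assume eq: "s * n + a = s' * n + a'"
  have "(s * n + a) div n = s" "(s * n + a) mod n = a"
       "(s' * n + a') div n = s'" "(s' * n + a') mod n = a'"
    using assms by auto
  then show "s = s' \<and> a = a'" using eq by metis
qed simp

lemma all_block_index: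
  fixes n :: nat
  shows "(\<forall>i<n\<^sup>2. R i) \<longleftrightarrow> (\<forall>s<n. \<forall>a<n. R (s * n + a))"
  by (auto simp: block_index_less elim!: block_indexE)

text \<open>The map \<open>(s, a)\<close> to \<open>s * n + a\<close> is injective and reaches every
  index below \<open>n\<^sup>2\<close>, so both solution sets have the same cardinality, and unique
  existence means cardinality 1. This moves uniqueness in a row or column to block
  coordinates.\<close>

lemma ex1_block_index:
  fixes n :: nat
  shows "(\<exists>!i. i < n\<^sup>2 \<and> R i) \<longleftrightarrow> (\<exists>!(s, a). s < n \<and> a < n \<and> R (s * n + a))"
proof -
  define I where "I = {(s, a). s < n \<and> a < n \<and> R (s * n + a)}"
  have im: "{i. i < n\<^sup>2 \<and> R i} = (\<lambda>(s, a). s * n + a) ` I"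
    unfolding I_def by (auto simp: block_index_less image_iff elim: block_indexE)
  have inj: "inj_on (\<lambda>(s, a). s * n + a) I"
    unfolding I_def inj_on_def by (auto simp: block_index_inj)
  have ex1: "(\<exists>!x. Q x) \<longleftrightarrow> card {x. Q x} = 1" for Q :: "'b \<Rightarrow> bool"
    unfolding One_nat_def card_1_singleton_iff set_eq_iff mem_Collect_eq singleton_iff by metis
  have "(\<exists>!i. i < n\<^sup>2 \<and> R i) \<longleftrightarrow> card I = 1"
    unfolding ex1 im card_image[OF inj] ..
  then show ?thesis unfolding ex1 I_def .
qed

text \<open>Bijectivity amounts to every value having exactly one preimage. Values are written
  \<open>a + 1\<close> with \<open>a < n\<close> so that \<open>a\<close> can serve as a 0-based
  offset inside a block.\<close>

lemma bij_betw_lessThan_iff_ex1: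
  fixes f :: "nat \<Rightarrow> nat"
  assumes "\<And>t. t < n \<Longrightarrow> f t \<in> {1..n}"
  shows "bij_betw f {..<n} {1..n} \<longleftrightarrow> (\<forall>a<n. \<exists>!t. t < n \<and> f t = a + 1)"
proof
  assume bij: "bij_betw f {..<n} {1..n}"
  show "\<forall>a<n. \<exists>!t. t < n \<and> f t = a + 1"
  proof (intro allI impI)
    fix a assume "a < n"
    then have "a + 1 \<in> f ` {..<n}" using bij by (simp add: bij_betw_def Suc_le_eq)
    then show "\<exists>!t. t < n \<and> f t = a + 1"
      using bij unfolding bij_betw_def inj_on_def image_iff lessThan_iff by auto
  qed
next
  assume ex: "\<forall>a<n. \<exists>!t. t < n \<and> f t = a + 1"
  have ex': "\<exists>!t. t < n \<and> f t = b" if "b \<in> {1..n}" for b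
  proof -
    have "b - 1 < n" "b - 1 + 1 = b" using that by auto
    then show ?thesis using ex by metis
  qed
  show "bij_betw f {..<n} {1..n}"
  proof (rule bij_betw_imageI)
    show "inj_on f {..<n}"
      using assms ex' unfolding inj_on_def lessThan_iff by blast
    show "f ` {..<n} = {1..n}"
    proof
      show "{1..n} \<subseteq> f ` {..<n}" using ex' by blast
    qed (use assms in blast)
  qed
qed

section \<open>The encoding without the permutation conditions\<close>

definition entry_mats :: "nat \<Rightarrow> nat mat set" where
  "entry_mats n = {C \<in> carrier_mat (2 * n) n. elements_mat C \<subseteq> {1..n}}"

text \<open>Like \<open>entry_mats\<close> for \<open>Pi_mats\<close>, this is
  \<open>Sigma_mats\<close> freed from the permutation requirement. Binarity is kept, so that the
  positions of the ones determine the whole matrix.\<close>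

definition block_mats :: "nat \<Rightarrow> nat mat set" where
  "block_mats n = {A \<in> carrier_mat (n\<^sup>2) (n\<^sup>2). binary_mat A \<and>
     (\<forall>s < n. \<forall>t < n. \<exists>!(a, b). a < n \<and> b < n \<and> A $$ (s * n + a, t * n + b) = 1)}"

definition block_encode :: "nat \<Rightarrow> nat mat \<Rightarrow> nat mat" where
  "block_encode n C = mat (n\<^sup>2) (n\<^sup>2) (\<lambda>(i, j).
     if C $$ (i div n, j div n) = i mod n + 1 \<and> C $$ (n + j div n, i div n) = j mod n + 1
     then 1 else 0)"

lemma entry_matsD:
  assumes "C \<in> entry_mats n" "i < 2 * n" "j < n"
  shows "C $$ (i, j) \<in> {1..n}"
  using assms unfolding entry_mats_def by (auto dest!: elements_matI[OF _ _ _ refl])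

lemma entry_matsE:
  assumes "C \<in> entry_mats n" "s < n" "t < n"
  obtains a b where "a < n" "b < n" "C $$ (s, t) = a + 1" "C $$ (n + t, s) = b + 1"
proof -
  have "C $$ (s, t) \<in> {1..n}" "C $$ (n + t, s) \<in> {1..n}"
    using entry_matsD[OF assms(1)] assms(2,3) by simp_all
  then show ?thesis
    using that[of "C $$ (s, t) - 1" "C $$ (n + t, s) - 1"] by auto
qed

lemma block_encode_carrier [simp]: "block_encode n C \<in> carrier_mat (n\<^sup>2) (n\<^sup>2)"
  by (simp add: block_encode_def)

lemma block_encode_dim [simp]:
  "dim_row (block_encode n C) = n\<^sup>2" "dim_col (block_encode n C) = n\<^sup>2"
  by (simp_all add: block_encode_def)

lemma block_encode_index:
  assumes "s < n" "a < n" "t < n" "b < n"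
  shows "block_encode n C $$ (s * n + a, t * n + b) =
    (if C $$ (s, t) = a + 1 \<and> C $$ (n + t, s) = b + 1 then 1 else 0)"
  using assms by (simp add: block_encode_def block_index_less)

lemma block_encode_eq_1_iff:
  assumes "s < n" "a < n" "t < n" "b < n"
  shows "block_encode n C $$ (s * n + a, t * n + b) = 1 \<longleftrightarrow>
    C $$ (s, t) = a + 1 \<and> C $$ (n + t, s) = b + 1"
  unfolding block_encode_index[OF assms] by simp

lemma binary_block_encode: "binary_mat (block_encode n C)"
  by (auto simp: binary_mat_def block_encode_def elements_mat_def)

lemma block_encode_in_block_mats:
  assumes "C \<in> entry_mats n"
  shows "block_encode n C \<in> block_mats n"
proof -
  have "\<exists>!(a, b). a < n \<and> b < n \<and> block_encode n C $$ (s * n + a, t * n + b) = 1"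
    if st: "s < n" "t < n" for s t
  proof -
    obtain a b where "a < n" "b < n" "C $$ (s, t) = a + 1" "C $$ (n + t, s) = b + 1"
      using assms st by (rule entry_matsE)
    then show ?thesis
      using st by (intro ex1I[of _ "(a, b)"]) (auto simp: block_encode_index split: if_splits)
  qed
  then show ?thesis by (simp add: block_mats_def binary_block_encode)
qed

text \<open>Equal pairs at \<open>(s, t)\<close> put both ones of block \<open>(s, t)\<close> at the
  same position, which lies inside the block because the entries of \<open>P\<close> are in
  \<open>{1..n}\<close>. Conversely, a shared 1 determines the pair of both matrices.\<close>

lemma block_encode_disjoint_iff:
  assumes "P \<in> entry_mats n"
  shows "Pi_disjoint n P Q \<longleftrightarrow> binary_disjoint (block_encode n P) (block_encode n Q)"
proof -
  let ?P = "block_encode n P" and ?Q = "block_encode n Q"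
  have agree: "(P $$ (s, t), P $$ (n + t, s)) = (Q $$ (s, t), Q $$ (n + t, s)) \<longleftrightarrow>
      (\<exists>a<n. \<exists>b<n. ?P $$ (s * n + a, t * n + b) = 1 \<and> ?Q $$ (s * n + a, t * n + b) = 1)"
    if st: "s < n" "t < n" for s t
  proof
    assume eq: "(P $$ (s, t), P $$ (n + t, s)) = (Q $$ (s, t), Q $$ (n + t, s))"
    obtain a b where ab: "a < n" "b < n" "P $$ (s, t) = a + 1" "P $$ (n + t, s) = b + 1"
      using assms st by (rule entry_matsE)
    then have "?P $$ (s * n + a, t * n + b) = 1 \<and> ?Q $$ (s * n + a, t * n + b) = 1"
      using eq st by (simp add: block_encode_index)
    with ab show "\<exists>a<n. \<exists>b<n. ?P $$ (s * n + a, t * n + b) = 1 \<and> ?Q $$ (s * n + a, t * n + b) = 1"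
      by blast
  next
    assume "\<exists>a<n. \<exists>b<n. ?P $$ (s * n + a, t * n + b) = 1 \<and> ?Q $$ (s * n + a, t * n + b) = 1"
    then obtain a b where "a < n" "b < n"
      "?P $$ (s * n + a, t * n + b) = 1" "?Q $$ (s * n + a, t * n + b) = 1"
      by blast
    then show "(P $$ (s, t), P $$ (n + t, s)) = (Q $$ (s, t), Q $$ (n + t, s))"
      using st by (simp only: block_encode_eq_1_iff)
  qed
  have "binary_disjoint ?P ?Q \<longleftrightarrow>
      (\<forall>i<n\<^sup>2. \<forall>j<n\<^sup>2. \<not> (?P $$ (i, j) = 1 \<and> ?Q $$ (i, j) = 1))"
    unfolding binary_disjoint_def block_encode_dim by blast
  also have "\<dots> \<longleftrightarrow> \<not> (\<exists>s<n. \<exists>t<n. \<exists>a<n. \<exists>b<n.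
      ?P $$ (s * n + a, t * n + b) = 1 \<and> ?Q $$ (s * n + a, t * n + b) = 1)"
    unfolding all_block_index by auto
  also have "\<dots> \<longleftrightarrow> Pi_disjoint n P Q"
    unfolding Pi_disjoint_def by (simp only: agree cong: conj_cong)
  finally show ?thesis by simp
qed

lemma inj_on_block_encode: "inj_on (block_encode n) (entry_mats n)"
proof (rule inj_onI)
  fix C D
  assume C: "C \<in> entry_mats n" and D: "D \<in> entry_mats n"
    and eq: "block_encode n C = block_encode n D"
  have agree: "C $$ (s, t) = D $$ (s, t) \<and> C $$ (n + t, s) = D $$ (n + t, s)"
    if st: "s < n" "t < n" for s t
  proof -
    obtain a b where ab: "a < n" "b < n" "C $$ (s, t) = a + 1" "C $$ (n + t, s) = b + 1"
      using C st by (rule entry_matsE)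
    then have "block_encode n D $$ (s * n + a, t * n + b) = 1"
      using st by (simp add: block_encode_index flip: eq)
    then show ?thesis
      unfolding block_encode_eq_1_iff[OF st(1) ab(1) st(2) ab(2)] using ab by simp
  qed
  show "C = D"
  proof (rule eq_matI)
    fix i j assume "i < dim_row D" "j < dim_col D"
    then have ij: "i < 2 * n" "j < n" using D by (auto simp: entry_mats_def)
    show "C $$ (i, j) = D $$ (i, j)"
    proof (cases "i < n")
      case False
      \<comment> \<open>The lower half is stored transposed: row \<open>i = n + t\<close> at column
        \<open>j\<close> belongs to block \<open>(j, t)\<close>.\<close>
      then show ?thesis using agree[of j "i - n"] ij by auto
    qed (use agree ij in auto)
  qed (use C D in \<open>auto simp: entry_mats_def\<close>)
qed

lemma block_encode_surj:
  assumes "A \<in> block_mats n"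
  shows "\<exists>C \<in> entry_mats n. block_encode n C = A"
proof -
  have A: "A \<in> carrier_mat (n\<^sup>2) (n\<^sup>2)" "binary_mat A"
    and ex1: "\<And>s t. s < n \<Longrightarrow> t < n \<Longrightarrow>
      \<exists>!(a, b). a < n \<and> b < n \<and> A $$ (s * n + a, t * n + b) = 1"
    using assms unfolding block_mats_def by auto
  \<comment> \<open>Unique existence becomes an equivalence, from which a function \<open>p\<close>
    giving the position of the 1 in each block can be chosen.\<close>
  have "\<exists>p. \<forall>a b. a < n \<and> b < n \<and> A $$ (s * n + a, t * n + b) = 1 \<longleftrightarrow> (a, b) = p"
    if "s < n" "t < n" for s t
    using ex1[OF that] by (elim ex1E) (auto simp del: One_nat_def)
  then obtain p where p: "\<And>s t a b. s < n \<Longrightarrow> t < n \<Longrightarrow>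
      a < n \<and> b < n \<and> A $$ (s * n + a, t * n + b) = 1 \<longleftrightarrow> (a, b) = p s t"
    by metis
  have p_less: "fst (p s t) < n \<and> snd (p s t) < n" if "s < n" "t < n" for s t
    using p[OF that, of "fst (p s t)" "snd (p s t)"] by simp
  \<comment> \<open>The preimage reads off these positions: row offsets fill the upper half, column
    offsets, transposed, the lower half, each raised by 1 to land in \<open>{1..n}\<close>.\<close>
  define C where "C = mat (2 * n) n (\<lambda>(i, j).
    if i < n then fst (p i j) + 1 else snd (p j (i - n)) + 1)"
  have "C \<in> entry_mats n"
    using p_less by (auto simp: C_def entry_mats_def elements_mat_def Suc_le_eq split: if_splits)
  moreover have "block_encode n C = A"
  proof (rule eq_matI)
    fix i j assume "i < dim_row A" "j < dim_col A"
    then have ij: "i < n\<^sup>2" "j < n\<^sup>2" using A by auto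
    obtain s a where sa: "s < n" "a < n" "i = s * n + a"
      using ij(1) by (rule block_indexE)
    obtain t b where tb: "t < n" "b < n" "j = t * n + b"
      using ij(2) by (rule block_indexE)
    note st = sa(1,2) tb(1,2) and ij_eq = sa(3) tb(3)
    \<comment> \<open>As \<open>A\<close> is binary, agreement on where the ones are will suffice
      for equality.\<close>
    have "A $$ (i, j) \<in> elements_mat A"
      using A ij by (intro elements_matI[of _ "n\<^sup>2" "n\<^sup>2"]) auto
    then have bin: "A $$ (i, j) = 0 \<or> A $$ (i, j) = 1"
      using A by (auto simp: binary_mat_def)
    have "A $$ (i, j) = 1 \<longleftrightarrow> (a, b) = p s t"
      using p[of s t a b] st by (simp add: ij_eq)
    also have "\<dots> \<longleftrightarrow> C $$ (s, t) = a + 1 \<and> C $$ (n + t, s) = b + 1"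
      using st by (cases "p s t") (auto simp: C_def)
    finally show "block_encode n C $$ (i, j) = A $$ (i, j)"
      unfolding ij_eq block_encode_index[OF st] using bin by (auto simp: ij_eq)
  qed (use A in auto)
  ultimately show ?thesis by blast
qed

lemma bij_betw_block_encode: "bij_betw (block_encode n) (entry_mats n) (block_mats n)"
  unfolding bij_betw_def
  using inj_on_block_encode block_encode_in_block_mats block_encode_surj by blast

section \<open>Matching the permutation conditions and restricting the bijection\<close>

lemma permutation_block_encode_iff:
  assumes C: "C \<in> entry_mats n"
  shows "permutation_mat (block_encode n C) \<longleftrightarrow>
    (\<forall>i < 2 * n. bij_betw (\<lambda>j. C $$ (i, j)) {..<n} {1..n})"
proof -
  let ?A = "block_encode n C"
  have row: "(\<exists>!j. j < n\<^sup>2 \<and> ?A $$ (s * n + a, j) = 1) \<longleftrightarrow> (\<exists>!t. t < n \<and> C $$ (s, t) = a + 1)"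
    if sa: "s < n" "a < n" for s a
  proof -
    \<comment> \<open>Once \<open>t\<close> is known, the offset \<open>b\<close> is forced, so
      counting pairs \<open>(t, b)\<close> is counting \<open>t\<close>. The truncated subtraction
      is harmless since entries of \<open>C\<close> are at least 1.\<close>
    have "(\<exists>!j. j < n\<^sup>2 \<and> ?A $$ (s * n + a, j) = 1) \<longleftrightarrow>
        (\<exists>!(t, b). t < n \<and> C $$ (s, t) = a + 1 \<and> b = C $$ (n + t, s) - 1)"
      unfolding ex1_block_index
    proof (intro arg_cong[of _ _ Ex1] ext, clarify)
      fix t b
      show "(t < n \<and> b < n \<and> ?A $$ (s * n + a, t * n + b) = 1) =
          (t < n \<and> C $$ (s, t) = a + 1 \<and> b = C $$ (n + t, s) - 1)"
        using sa entry_matsD[OF C, of "n + t" s]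
        by (cases "t < n"; cases "b < n") (auto simp: block_encode_index split: if_splits)
    qed
    also have "\<dots> \<longleftrightarrow> (\<exists>!t. t < n \<and> C $$ (s, t) = a + 1)" by auto
    finally show ?thesis .
  qed
  have col: "(\<exists>!i. i < n\<^sup>2 \<and> ?A $$ (i, t * n + b) = 1) \<longleftrightarrow> (\<exists>!s. s < n \<and> C $$ (n + t, s) = b + 1)"
    if tb: "t < n" "b < n" for t b
  proof -
    have "(\<exists>!i. i < n\<^sup>2 \<and> ?A $$ (i, t * n + b) = 1) \<longleftrightarrow>
        (\<exists>!(s, a). s < n \<and> C $$ (n + t, s) = b + 1 \<and> a = C $$ (s, t) - 1)"
      unfolding ex1_block_index
    proof (intro arg_cong[of _ _ Ex1] ext, clarify)
      fix s a
      show "(s < n \<and> a < n \<and> ?A $$ (s * n + a, t * n + b) = 1) =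
          (s < n \<and> C $$ (n + t, s) = b + 1 \<and> a = C $$ (s, t) - 1)"
        using tb entry_matsD[OF C, of s t]
        by (cases "s < n"; cases "a < n") (auto simp: block_encode_index split: if_splits)
    qed
    also have "\<dots> \<longleftrightarrow> (\<exists>!s. s < n \<and> C $$ (n + t, s) = b + 1)" by auto
    finally show ?thesis .
  qed
  have bij: "bij_betw (\<lambda>j. C $$ (i, j)) {..<n} {1..n} \<longleftrightarrow>
      (\<forall>a<n. \<exists>!j. j < n \<and> C $$ (i, j) = a + 1)" if "i < 2 * n" for i
    using entry_matsD[OF C that] by (rule bij_betw_lessThan_iff_ex1)
  \<comment> \<open>The upper rows of \<open>C\<close> answer for the rows of \<open>?A\<close>, the
    lower ones for its columns.\<close>
  have halves: "(\<forall>i<2 * n. R i) \<longleftrightarrow> (\<forall>s<n. R s) \<and> (\<forall>t<n. R (n + t))" for R :: "nat \<Rightarrow> bool"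
  proof (intro iffI allI impI)
    fix i assume R: "(\<forall>s<n. R s) \<and> (\<forall>t<n. R (n + t))" and "i < 2 * n"
    then show "R i" using R[THEN conjunct2, rule_format, of "i - n"] by (cases "i < n") auto
  qed auto
  have "permutation_mat ?A \<longleftrightarrow>
      (\<forall>s<n. \<forall>a<n. \<exists>!j. j < n\<^sup>2 \<and> ?A $$ (s * n + a, j) = 1) \<and>
      (\<forall>t<n. \<forall>b<n. \<exists>!i. i < n\<^sup>2 \<and> ?A $$ (i, t * n + b) = 1)"
    unfolding permutation_mat_def block_encode_dim all_block_index
    by (simp add: binary_block_encode)
  also have "\<dots> \<longleftrightarrow> (\<forall>i < 2 * n. bij_betw (\<lambda>j. C $$ (i, j)) {..<n} {1..n})"
    unfolding halves by (simp add: row col bij del: One_nat_def)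
  finally show ?thesis .
qed

lemma Pi_mats_eq:
  "Pi_mats n = {C \<in> entry_mats n. \<forall>i < 2 * n. bij_betw (\<lambda>j. C $$ (i, j)) {..<n} {1..n}}"
  by (auto simp: Pi_mats_def entry_mats_def)

text \<open>Entries of \<open>mat_block\<close> unfold to entries of \<open>A\<close>, and binarity
  is part of \<open>permutation_mat\<close>.\<close>

lemma Sigma_mats_eq: "Sigma_mats n = {A \<in> block_mats n. permutation_mat A}"
proof -
  have "(\<lambda>p. p \<in> {..<n} \<times> {..<n} \<and> mat_block n A s t $$ p = 1) =
      (\<lambda>(a, b). a < n \<and> b < n \<and> A $$ (s * n + a, t * n + b) = 1)" for A s t
    by (auto simp: mat_block_def fun_eq_iff)
  then show ?thesis
    unfolding Sigma_mats_def block_mats_def by (auto simp: permutation_mat_def)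
qed

theorem theorem1:
  fixes n :: nat
  assumes "n > 0"
  shows "\<exists>\<phi>. bij_betw \<phi> (Pi_mats n) (Sigma_mats n) \<and>
    (\<forall>P \<in> Pi_mats n. \<forall>Q \<in> Pi_mats n.
       Pi_disjoint n P Q \<longleftrightarrow> binary_disjoint (\<phi> P) (\<phi> Q))"
proof (intro exI conjI ballI)
  have "Pi_mats n \<subseteq> entry_mats n" by (auto simp: Pi_mats_eq)
  \<comment> \<open>Every member of \<open>block_mats n\<close> is an encoding, and it is a
    permutation matrix exactly when its preimage has permutation rows, so the larger bijection
    restricts.\<close>
  moreover have "block_encode n ` Pi_mats n = Sigma_mats n"
    unfolding Sigma_mats_eq bij_betw_imp_surj_on[OF bij_betw_block_encode, symmetric]
    by (auto simp: Pi_mats_eq permutation_block_encode_iff simp del: One_nat_def)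
  ultimately show "bij_betw (block_encode n) (Pi_mats n) (Sigma_mats n)"
    by (rule bij_betw_subset[OF bij_betw_block_encode])
qed (simp add: Pi_mats_eq block_encode_disjoint_iff)

end
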